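(* There is a Polish space $X$ and an acyclic $\aleph_0$-regular Borel graph $G$ on $X$ which does not have a Borel perfect matching on a comeager Borel set; that is, for no comeager Borel set $C \subseteq X$ does the restriction of $G$ to $C$ have a Borel perfect matching.
   Context: A graph on a set $X$ is an irreflexive symmetric subset $G$ of $X \times X$; it is Borel if it is a Borel subset of $X \times X$. The restriction of $G$ to $Y \subseteq X$ is $G \cap (Y \times Y)$, regarded as a graph on $Y$. A $G$-path is a finite sequence $(x_i)_{i \le n}$ with $x_i \mathrel{G} x_{i+1}$ for all $i < n$; $G$ is acyclic if there is at most one injective $G$-path between any two points. $G$ is $\aleph_0$-regular if every point $y$ has exactly $\aleph_0$ many $G$-neighbors, i.e., $|\{x \in X : x \mathrel{G} y\}| = \aleph_0$. A matching of $G$ is an involution (a permutation that is its own inverse) of a subset of $X$ whose graph is contained in $G$; it is perfect if its domain is all of the vertex set. A matching is Borel if its domain is Borel and it is a Borel function. A set is meager if it is a countable union of nowhere dense sets, and comeager if its complement is meager. *)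

theory Defs
  imports "HOL-Analysis.Analysis"
begin

definition Polish_space :: "'a topology \<Rightarrow> bool" where
  "Polish_space X \<longleftrightarrow> completely_metrizable_space X \<and> separable_space X"

definition Borel_of :: "'a topology \<Rightarrow> 'a measure" where
  "Borel_of X = sigma (topspace X) {U. openin X U}"

lemma space_Borel_of [simp]: "space (Borel_of X) = topspace X"
  unfolding Borel_of_def by (rule space_measure_of) (auto dest: openin_subset)

lemma sets_Borel_of: "sets (Borel_of X) = sigma_sets (topspace X) {U. openin X U}"
  unfolding Borel_of_def by (rule sets_measure_of) (auto dest: openin_subset)

definition nowhere_dense_in :: "'a topology \<Rightarrow> 'a set \<Rightarrow> bool" where
  "nowhere_dense_in X S \<longleftrightarrow> S \<subseteq> topspace X \<and> X interior_of (X closure_of S) = {}"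

definition meager_in :: "'a topology \<Rightarrow> 'a set \<Rightarrow> bool" where
  "meager_in X S \<longleftrightarrow> (\<exists>\<N>. countable \<N> \<and> (\<forall>N\<in>\<N>. nowhere_dense_in X N) \<and> S = \<Union>\<N>)"

definition comeager_in :: "'a topology \<Rightarrow> 'a set \<Rightarrow> bool" where
  "comeager_in X S \<longleftrightarrow> S \<subseteq> topspace X \<and> meager_in X (topspace X - S)"

definition graph_on :: "'a set \<Rightarrow> ('a \<times> 'a) set \<Rightarrow> bool" where
  "graph_on V G \<longleftrightarrow> G \<subseteq> V \<times> V \<and> irrefl G \<and> sym G"

definition Borel_graph :: "'a topology \<Rightarrow> ('a \<times> 'a) set \<Rightarrow> bool" where
  "Borel_graph X G \<longleftrightarrow> graph_on (topspace X) G \<and> G \<in> sets (Borel_of (prod_topology X X))"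

definition graph_restrict :: "('a \<times> 'a) set \<Rightarrow> 'a set \<Rightarrow> ('a \<times> 'a) set" where
  "graph_restrict G Y = G \<inter> (Y \<times> Y)"

text \<open>A path \<open>(x\<^sub>i)\<close>, \<open>i \<le> n\<close>, is the nonempty list of its \<open>n + 1\<close> points; it is injective
  iff the list is distinct.\<close>

definition graph_path :: "'a set \<Rightarrow> ('a \<times> 'a) set \<Rightarrow> 'a \<Rightarrow> 'a list \<Rightarrow> 'a \<Rightarrow> bool" where
  "graph_path V G x p y \<longleftrightarrow>
     p \<noteq> [] \<and> set p \<subseteq> V \<and> hd p = x \<and> last p = y \<and>
     (\<forall>i. Suc i < length p \<longrightarrow> (p ! i, p ! Suc i) \<in> G)"

definition acyclic_graph :: "'a set \<Rightarrow> ('a \<times> 'a) set \<Rightarrow> bool" where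
  "acyclic_graph V G \<longleftrightarrow>
     (\<forall>x\<in>V. \<forall>y\<in>V. \<forall>p q. graph_path V G x p y \<and> distinct p \<and>
        graph_path V G x q y \<and> distinct q \<longrightarrow> p = q)"

definition aleph0_regular :: "'a set \<Rightarrow> ('a \<times> 'a) set \<Rightarrow> bool" where
  "aleph0_regular V G \<longleftrightarrow> (\<forall>y\<in>V. {x \<in> V. (x, y) \<in> G} \<approx> (UNIV :: nat set))"

text \<open>A partial function is given by its domain \<open>D\<close> and a total function of which only the values
  on \<open>D\<close> matter.\<close>

definition matching :: "'a set \<Rightarrow> ('a \<times> 'a) set \<Rightarrow> 'a set \<Rightarrow> ('a \<Rightarrow> 'a) \<Rightarrow> bool" where
  "matching V G D f \<longleftrightarrow>
     D \<subseteq> V \<and> bij_betw f D D \<and> (\<forall>x\<in>D. f (f x) = x) \<and> (\<forall>x\<in>D. (x, f x) \<in> G)"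

definition perfect_matching :: "'a set \<Rightarrow> ('a \<times> 'a) set \<Rightarrow> 'a set \<Rightarrow> ('a \<Rightarrow> 'a) \<Rightarrow> bool" where
  "perfect_matching V G D f \<longleftrightarrow> matching V G D f \<and> D = V"

definition Borel_partial_function :: "'a topology \<Rightarrow> 'a set \<Rightarrow> ('a \<Rightarrow> 'a) \<Rightarrow> bool" where
  "Borel_partial_function X D f \<longleftrightarrow>
     D \<in> sets (Borel_of X) \<and> f \<in> restrict_space (Borel_of X) D \<rightarrow>\<^sub>M Borel_of X"

definition has_Borel_perfect_matching :: "'a topology \<Rightarrow> ('a \<times> 'a) set \<Rightarrow> bool" where
  "has_Borel_perfect_matching X G \<longleftrightarrow>
     (\<exists>D f. perfect_matching (topspace X) G D f \<and> Borel_partial_function X D f)"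

text \<open>HOL cannot quantify existentially over types, so "there is a Polish space" needs a fixed
  ground type. Every Polish space has at most continuum many points, hence its topology transports
  along an injection to some \<^typ>\<open>(nat \<Rightarrow> nat) topology\<close> (with an arbitrary subset of
  \<^typ>\<open>nat \<Rightarrow> nat\<close> as its \<^const>\<open>topspace\<close>). Neither the points nor the topology need have
  anything to do with the Baire space: \<^typ>\<open>nat \<Rightarrow> nat\<close> serves only as a set of size continuum.\<close>

type_synonym point = "nat \<Rightarrow> nat"

end

theory Submission
  imports Defs "HOL-Library.Nat_Bijection"
begin

text \<open>The vertices come in three kinds: the sequences \<open>x\<close> in the Baire space; hubs \<open>(n, z)\<close>, consisting of
  a level \<open>n\<close> and a sequence \<open>z\<close>; and the nodes of some auxiliary trees. Fix a dense
  family of words \<open>s\<^sub>n\<close>, the stems, with \<open>s\<^sub>n\<close> of length \<open>n\<close>. The hub \<open>(n, z)\<close> is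
  adjacent to the sequences formed by \<open>s\<^sub>n\<close>, an arbitrary entry \<open>k\<close>, and \<open>z\<close>. This is the
  construction of the graph \<open>G\<^sub>0\<close> of Kechris, Solecki and Todorcevic, with infinitely many
  sequences meeting at each hub.

  A Borel perfect matching on a comeager set would violate Hall's condition in the sense of Baire
  category (\<open>no_Borel_perfect_matching\<close>). By the Baire property, the partners of the sequences in
  some nonempty open set \<open>U\<close> are generically hubs of one fixed level \<open>n\<close>. By density, \<open>U\<close> contains the
  cylinder of a stem \<open>s\<^sub>m\<close> with \<open>m \<noteq> n\<close>, and the nonmeager set of hubs of level \<open>m\<close> finds all its
  neighbours in this cylinder, where only a meager set of sequences is still unmatched. Since the
  edges are given by countably many continuous open maps, a meager set of sequences has only a meager set
  of neighbours, so most of these hubs have no partner.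

  Acyclicity has the same reason as for \<open>G\<^sub>0\<close>: the entry at position \<open>N\<close> can be changed only
  when the first \<open>N\<close> entries spell \<open>s\<^sub>N\<close>, so between two changes of the highest entry
  that a walk affects, the lower entries return to the same word, and the walk can be shortened. Here
  this is turned into a recursive description (\<open>side\<close>, \<open>bank\<close>) of a cut that separates the two
  ends of a given edge and is crossed by no other edge; \<open>acyclic_graph_if_bridges\<close> concludes.

  Every hub has countably infinitely many neighbours. A sequence has one hub for each stem that it
  passes through, which is infinitely many for a generic sequence but finitely many for a meager set of
  thin sequences (\<open>thin_meager\<close>). On each of these, infinitely many countable regular trees are
  hung. Generic sequences are not joined to such trees, so the matching argument is unaffected.\<close>

section \<open>Baire category\<close>

lemma nowhere_dense_in_subset:
  assumes "nowhere_dense_in X S" "T \<subseteq> S"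
  shows "nowhere_dense_in X T"
proof -
  have "X interior_of (X closure_of T) \<subseteq> X interior_of (X closure_of S)"
    by (intro interior_of_mono closure_of_mono assms)
  then show ?thesis using assms unfolding nowhere_dense_in_def by auto
qed

lemma meager_in_subset:
  assumes "meager_in X S" "T \<subseteq> S"
  shows "meager_in X T"
proof -
  obtain \<N> where \<N>: "countable \<N>" "\<forall>N\<in>\<N>. nowhere_dense_in X N" "S = \<Union>\<N>"
    using assms unfolding meager_in_def by auto
  have "countable ((\<inter>) T ` \<N>)" "T = \<Union>((\<inter>) T ` \<N>)" using \<N> assms(2) by auto
  moreover have "\<forall>N\<in>(\<inter>) T ` \<N>. nowhere_dense_in X N"
    using \<N>(2) nowhere_dense_in_subset by fastforce
  ultimately show ?thesis unfolding meager_in_def by (intro exI[of _ "(\<inter>) T ` \<N>"] conjI)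
qed

lemma meager_in_UN:
  assumes "countable I" "\<And>i. i \<in> I \<Longrightarrow> meager_in X (S i)"
  shows "meager_in X (\<Union>i\<in>I. S i)"
proof -
  have "\<forall>i\<in>I. \<exists>\<N>. countable \<N> \<and> (\<forall>N\<in>\<N>. nowhere_dense_in X N) \<and> S i = \<Union>\<N>"
    using assms(2) unfolding meager_in_def by auto
  then obtain \<N> where "\<forall>i\<in>I. countable (\<N> i) \<and> (\<forall>N\<in>\<N> i. nowhere_dense_in X N) \<and> S i = \<Union>(\<N> i)"
    by metis
  then have "countable (\<Union>i\<in>I. \<N> i) \<and> (\<forall>N\<in>(\<Union>i\<in>I. \<N> i). nowhere_dense_in X N) \<and>
      (\<Union>i\<in>I. S i) = \<Union>(\<Union>i\<in>I. \<N> i)"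
    using assms(1) by auto
  then show ?thesis unfolding meager_in_def by (rule exI)
qed

lemma meager_in_Un:
  assumes "meager_in X S" "meager_in X T"
  shows "meager_in X (S \<union> T)"
  using meager_in_UN[of "{True, False}" X "\<lambda>b. if b then S else T"] assms by (auto simp: Un_commute)

lemma closed_meager:
  assumes "closed S" "interior S = {}"
  shows "meager_in euclidean S"
  unfolding meager_in_def nowhere_dense_in_def
  by (rule exI[of _ "{S}"]) (use assms in \<open>simp add: closure_of_closedin\<close>)

text \<open>If the preimage of a nowhere dense closed set had interior, the image of that interior would be
  an open subset of the closed set, because the map is open.\<close>

lemma meager_vimage:
  fixes f :: "'a::topological_space \<Rightarrow> 'b::topological_space"
  assumes "continuous_on UNIV f" and op: "\<And>U. open U \<Longrightarrow> open (f ` U)"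
    and "meager_in euclidean S"
  shows "meager_in euclidean (f -` S)"
proof -
  obtain \<N> where \<N>: "countable \<N>" "\<forall>N\<in>\<N>. nowhere_dense_in euclidean N" "S = \<Union>\<N>"
    using assms(3) unfolding meager_in_def by auto
  have "meager_in euclidean (f -` N)" if "N \<in> \<N>" for N
  proof (rule meager_in_subset)
    show "meager_in euclidean (f -` closure N)"
    proof (rule closed_meager)
      show "closed (f -` closure N)" using assms(1) by (simp add: closed_vimage)
      have "f ` interior (f -` closure N) \<subseteq> interior (closure N)"
        using interior_subset[of "f -` closure N"] by (intro interior_maximal op open_interior) auto
      then show "interior (f -` closure N) = {}"
        using \<N>(2) that by (auto simp: nowhere_dense_in_def)
    qed
  qed (use closure_subset in auto)
  then have "meager_in euclidean (\<Union>N\<in>\<N>. f -` N)" using \<N>(1) by (intro meager_in_UN)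
  then show ?thesis using \<N>(3) by (simp add: vimage_Union)
qed

lemma completely_metrizable_seq: "completely_metrizable_space (euclidean :: (nat \<Rightarrow> nat) topology)"
proof -
  have "completely_metrizable_space (discrete_topology (UNIV :: nat set))"
    by (rule completely_metrizable_space_discrete_topology)
  moreover have "(euclidean :: nat topology) = discrete_topology UNIV"
    by (simp add: topology_eq open_discrete)
  ultimately show ?thesis
    unfolding euclidean_product_topology[symmetric]
    by (simp add: completely_metrizable_space_product_topology)
qed

lemma Polish_seq: "Polish_space (euclidean :: (nat \<Rightarrow> nat) topology)"
proof -
  obtain D :: "(nat \<Rightarrow> nat) set" where D: "countable D" "\<And>U. open U \<Longrightarrow> U \<noteq> {} \<Longrightarrow> \<exists>d\<in>D. d \<in> U"
    using countable_dense_setE by blast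
  have "closure D = UNIV"
    using D(2)[of "- closure D"] closure_subset[of D] by fastforce
  then show ?thesis
    using D(1) completely_metrizable_seq by (auto simp: Polish_space_def separable_space_def)
qed

lemma Baire_seq: "\<not> meager_in euclidean (UNIV :: (nat \<Rightarrow> nat) set)"
proof
  assume "meager_in euclidean (UNIV :: (nat \<Rightarrow> nat) set)"
  then obtain \<N> :: "(nat \<Rightarrow> nat) set set" where \<N>: "countable \<N>" "\<forall>N\<in>\<N>. nowhere_dense_in euclidean N" "UNIV = \<Union>\<N>"
    unfolding meager_in_def by auto
  have "euclidean interior_of \<Union>(closure ` \<N>) = {}"
    by (rule Baire_category_alt)
      (use \<N> completely_metrizable_seq in \<open>auto simp: nowhere_dense_in_def\<close>)
  moreover have "\<Union>(closure ` \<N>) = UNIV" using \<N>(3) closure_subset by blast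
  ultimately show False by simp
qed

text \<open>The Baire property, as an induction over the Borel hierarchy. For a complement, the open set is
  the interior of the complement of the old one; what is lost in between is a boundary, hence
  nowhere dense.\<close>

lemma borel_imp_Baire_property:
  fixes S :: "'a::topological_space set"
  assumes "S \<in> sets borel"
  shows "\<exists>U. open U \<and> meager_in euclidean (U - S) \<and> meager_in euclidean (S - U)"
proof -
  have "S \<in> sigma_sets UNIV {S. open S}" using assms by (simp add: sets_borel)
  then show ?thesis
  proof (induction rule: sigma_sets.induct)
    case (Basic a)
    have "meager_in euclidean ({} :: 'a set)" by (rule closed_meager) auto
    then show ?case using Basic by (intro exI[of _ a]) auto
  next
    case Empty
    have "meager_in euclidean ({} :: 'a set)" by (rule closed_meager) auto
    then show ?case by (intro exI[of _ "{}"]) auto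
  next
    case (Compl a)
    then obtain U where U: "open U" "meager_in euclidean (U - a)" "meager_in euclidean (a - U)" by blast
    have "meager_in euclidean (- U - interior (- U))"
    proof (rule closed_meager)
      show "closed (- U - interior (- U))" using U(1) by (intro closed_Diff closed_Compl open_interior)
      show "interior (- U - interior (- U)) = {}"
        using interior_mono[of "- U - interior (- U)" "- U"]
          interior_subset[of "- U - interior (- U)"] by blast
    qed
    then have "meager_in euclidean ((U - a) \<union> (- U - interior (- U)))" using U by (intro meager_in_Un)
    then have "meager_in euclidean ((UNIV - a) - interior (- U))" by (rule meager_in_subset) auto
    moreover have "meager_in euclidean (interior (- U) - (UNIV - a))"
      by (rule meager_in_subset[OF U(3)]) (use interior_subset[of "- U"] in blast)
    ultimately show ?case by (intro exI[of _ "interior (- U)"]) auto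
  next
    case (Union a)
    then obtain U where U: "\<And>i::nat. open (U i) \<and> meager_in euclidean (U i - a i) \<and> meager_in euclidean (a i - U i)"
      by metis
    have m: "meager_in euclidean (\<Union>i. U i - a i)" "meager_in euclidean (\<Union>i. a i - U i)"
      using U by (auto intro: meager_in_UN)
    have "meager_in euclidean ((\<Union>i. U i) - (\<Union>i. a i))"
      by (rule meager_in_subset[OF m(1)]) auto
    moreover have "meager_in euclidean ((\<Union>i. a i) - (\<Union>i. U i))"
      by (rule meager_in_subset[OF m(2)]) auto
    moreover have "open (\<Union>i. U i)" using U by auto
    ultimately show ?case by blast
  qed
qed

text \<open>Turns the mere measurability of a matching into information on its values, valid generically
  on some open set.\<close>

lemma nonmeager_borel_localize:
  fixes S :: "'a::topological_space set"
  assumes "S \<in> sets borel" "\<not> meager_in euclidean S"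
  obtains U where "open U" "U \<noteq> {}" "meager_in euclidean (U - S)"
  using borel_imp_Baire_property[OF assms(1)] assms(2) by fastforce

section \<open>Forests\<close>

text \<open>A graph is a forest as soon as every edge is a bridge. The bridges are witnessed by a cut
  \<open>S\<close> crossed by no other edge, which need not be a connected component, so that it can be chosen
  by an explicit description.

  For uniqueness of injective paths with common ends, consider the first step \<open>(x, a)\<close> of one path and
  its cut. That path never returns to \<open>x\<close>, so it stays beyond the cut; hence the other path, which also
  starts at \<open>x\<close>, has to cross the cut too, and can do so only through \<open>(x, a)\<close>, at its very
  first step.\<close>

lemma acyclic_graph_if_bridges:
  assumes bridge: "\<And>a b. (a, b) \<in> H \<Longrightarrow>
      \<exists>S. a \<in> S \<and> b \<notin> S \<and> (\<forall>(u, v)\<in>H. (u \<in> S \<longleftrightarrow> v \<in> S) \<or> (u = a \<and> v = b))"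
  shows "acyclic_graph V (H \<union> H\<inverse>)"
proof -
  let ?G = "H \<union> H\<inverse>"
  have cut: "\<exists>S. a \<in> S \<and> b \<notin> S \<and> (\<forall>(u, v)\<in>?G. u \<in> S \<and> v \<notin> S \<longrightarrow> u = a \<and> v = b) \<and>
     (\<forall>(u, v)\<in>?G. u \<notin> S \<and> v \<in> S \<longrightarrow> u = b \<and> v = a)" if ab: "(a, b) \<in> ?G" for a b
    using ab
  proof
    assume "(a, b) \<in> H"
    from bridge[OF this] obtain S where
      "a \<in> S \<and> b \<notin> S \<and> (\<forall>(u, v)\<in>H. (u \<in> S \<longleftrightarrow> v \<in> S) \<or> (u = a \<and> v = b))" by blast
    then show ?thesis by (intro exI[of _ S]) fast
  next
    assume "(a, b) \<in> H\<inverse>"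
    then have "(b, a) \<in> H" by simp
    from bridge[OF this] obtain S where
      "b \<in> S \<and> a \<notin> S \<and> (\<forall>(u, v)\<in>H. (u \<in> S \<longleftrightarrow> v \<in> S) \<or> (u = b \<and> v = a))" by blast
    then show ?thesis by (intro exI[of _ "- S"]) fast
  qed
  have step: "successively (\<lambda>u v. (u, v) \<in> ?G) p"
    if "graph_path V ?G x p y" for x p y
    using that unfolding graph_path_def by (auto simp: successively_conv_nth)
  have "p = q" if "successively (\<lambda>u v. (u, v) \<in> ?G) p" "distinct p"
      "successively (\<lambda>u v. (u, v) \<in> ?G) q" "distinct q"
      "p \<noteq> []" "q \<noteq> []" "hd p = hd q" "last p = last q" for p q
    using that
  proof (induction p arbitrary: q)
    case (Cons x p)
    obtain q' where q: "q = x # q'" using Cons.prems by (cases q) auto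
    show ?case
    proof (cases "p = [] \<or> q' = []")
      case True
      then show ?thesis using Cons.prems q by (auto split: if_splits dest: last_in_set)
    next
      case False
      then obtain a p1 b q1 where p1: "p = a # p1" and q1: "q' = b # q1" by (meson neq_Nil_conv)
      have xa: "(x, a) \<in> ?G" using Cons.prems p1 by auto
      obtain S where S: "x \<in> S" "a \<notin> S" "\<forall>(u, v)\<in>?G. u \<in> S \<and> v \<notin> S \<longrightarrow> u = x \<and> v = a"
          "\<forall>(u, v)\<in>?G. u \<notin> S \<and> v \<in> S \<longrightarrow> u = a \<and> v = x"
        using cut[OF xa] by blast
      have stay: "set r \<subseteq> - S" if "successively (\<lambda>u v. (u, v) \<in> ?G) r" "x \<notin> set r" "r \<noteq> []" "hd r \<notin> S" for r
        using that
      proof (induction r)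
        case (Cons c r)
        then show ?case using S(4) by (cases r) auto
      qed simp
      have stay': "set r \<subseteq> S" if "successively (\<lambda>u v. (u, v) \<in> ?G) r" "x \<notin> set r" "r \<noteq> []" "hd r \<in> S" for r
        using that
      proof (induction r)
        case (Cons c r)
        then show ?case using S(3) by (cases r) auto
      qed simp
      have "last p \<notin> S" 
        using stay[of p] Cons.prems S(2) p1 last_in_set[of p] by (auto simp: successively_Cons)
      moreover have "last p = last q'" using Cons.prems p1 q q1 by simp
      ultimately have "last q' \<notin> S" by simp
      then have "b \<notin> S" using stay'[of q'] Cons.prems q q1 last_in_set[of q'] by (auto simp: successively_Cons)
      then have "b = a" using S(1,3) Cons.prems q q1 by auto
      then have "p = q'" using Cons.prems q q1 p1 by (intro Cons.IH) auto
      then show ?thesis using q by simp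
    qed
  qed simp
  then show ?thesis unfolding acyclic_graph_def using step by (auto simp: graph_path_def)
qed

section \<open>The graph\<close>

text \<open>The \<open>n\<close>-th stem is a finite word of length \<open>n\<close>, stored as a function of which only the arguments
  below \<open>n\<close> matter. It is a list read off from \<open>n\<close>, truncated or padded with zeros; each list is read off
  from arbitrarily large \<open>n\<close>, so that the stems are dense.\<close>

definition stem :: "nat \<Rightarrow> nat \<Rightarrow> nat" where
  "stem n i = (let u = list_decode (fst (prod_decode n)) in if i < length u then u ! i else 0)"

definition passes :: "nat \<Rightarrow> (nat \<Rightarrow> nat) \<Rightarrow> bool" where
  "passes n x \<longleftrightarrow> (\<forall>i<n. x i = stem n i)"

definition tail :: "nat \<Rightarrow> (nat \<Rightarrow> nat) \<Rightarrow> nat \<Rightarrow> nat" where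
  "tail n x = (\<lambda>i. x (i + Suc n))"

definition glue :: "nat \<Rightarrow> nat \<Rightarrow> (nat \<Rightarrow> nat) \<Rightarrow> nat \<Rightarrow> nat" where
  "glue n k z = (\<lambda>i. if i < n then stem n i else if i = n then k else z (i - Suc n))"

text \<open>These sequences pass through too few stems to have infinitely many hubs as neighbours; the trees
  hung on them below make up for it.\<close>

definition thin :: "(nat \<Rightarrow> nat) set" where
  "thin = {x. finite {n. passes n x}}"

text \<open>A point of the Baire space is a natural number, which encodes the kind of the vertex, followed
  by a sequence. The vertices \<open>tree_vertex [] x\<close> are the ones that a matching must treat with care;
  the \<open>tree_vertex t x\<close> with \<open>t \<noteq> []\<close> are nodes of the trees hung on \<open>x\<close>.\<close>

definition tree_vertex :: "nat list \<Rightarrow> (nat \<Rightarrow> nat) \<Rightarrow> point" where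
  "tree_vertex t x = case_nat (sum_encode (Inl (list_encode t))) x"

definition hub_vertex :: "nat \<Rightarrow> (nat \<Rightarrow> nat) \<Rightarrow> point" where
  "hub_vertex n z = case_nat (sum_encode (Inr n)) z"

text \<open>The edges, in one orientation. A hub \<open>hub_vertex n z\<close> is adjacent to all sequences that
  consist of the \<open>n\<close>-th stem, one arbitrary entry, and \<open>z\<close>. On a thin sequence \<open>x\<close>, the countable
  regular forest with nodes \<open>tree_vertex t x\<close>, \<open>t \<noteq> []\<close>, is hung; for the other sequences it remains
  detached.\<close>

definition arcs :: "(point \<times> point) set" where
  "arcs = {(tree_vertex [] x, hub_vertex n (tail n x)) | n x. passes n x} \<union>
          {(tree_vertex t x, tree_vertex (t @ [m]) x) | t m x. t = [] \<longrightarrow> x \<in> thin}"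

definition hub_graph :: "(point \<times> point) set" where
  "hub_graph = arcs \<union> arcs\<inverse>"

lemma stem_dense: "\<exists>n\<ge>j. \<forall>i<N. stem n i = x i"
proof -
  define n where "n = prod_encode (list_encode (map x [0..<N]), j)"
  have "j \<le> n" unfolding n_def by (rule le_prod_encode_2)
  moreover have "\<forall>i<N. stem n i = x i" by (simp add: n_def stem_def)
  ultimately show ?thesis by blast
qed

lemma passes_glue [simp]: "passes n (glue n k z)"
  by (simp add: passes_def glue_def)

lemma tail_glue [simp]: "tail n (glue n k z) = z"
  by (simp add: tail_def glue_def)

lemma glue_at [simp]: "glue n k z n = k"
  by (simp add: glue_def)

lemma glue_tail: "passes n x \<Longrightarrow> glue n (x n) (tail n x) = x"
  by (auto simp: passes_def tail_def glue_def fun_eq_iff)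

lemma passes_tail_eqD:
  assumes "passes n x" "passes n y" "tail n x = tail n y" "i \<noteq> n"
  shows "x i = y i"
proof -
  have "x = glue n (x n) (tail n x)" "y = glue n (y n) (tail n x)"
    using assms glue_tail by metis+
  then show ?thesis using assms(4) by (metis glue_def)
qed

lemma case_nat_eq_iff: "(case_nat c x :: nat \<Rightarrow> 'a) = case_nat d y \<longleftrightarrow> c = d \<and> x = y"
proof
  assume eq: "(case_nat c x :: nat \<Rightarrow> 'a) = case_nat d y"
  have "c = d" using fun_cong[OF eq, of 0] by simp
  moreover have "x i = y i" for i using fun_cong[OF eq, of "Suc i"] by simp
  ultimately show "c = d \<and> x = y" by auto
qed simp

lemma vertex_eq_iff [simp]:
  "tree_vertex t x = tree_vertex t' x' \<longleftrightarrow> t = t' \<and> x = x'"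
  "hub_vertex n z = hub_vertex n' z' \<longleftrightarrow> n = n' \<and> z = z'"
  "tree_vertex t x \<noteq> hub_vertex n z"
  "hub_vertex n z \<noteq> tree_vertex t x"
  by (auto simp: tree_vertex_def hub_vertex_def case_nat_eq_iff sum_encode_eq list_encode_eq)

lemma vertex_cases:
  obtains t x where "p = tree_vertex t x" | n z where "p = hub_vertex n z"
proof -
  have p: "p = case_nat (p 0) (\<lambda>i. p (Suc i))" by (auto simp: fun_eq_iff split: nat.splits)
  show ?thesis
  proof (cases "sum_decode (p 0)")
    case (Inl l)
    then have "p 0 = sum_encode (Inl (list_encode (list_decode l)))"
      by (metis sum_decode_inverse list_decode_inverse)
    then show ?thesis using p that(1) unfolding tree_vertex_def by metis
  next
    case (Inr n)
    then have "p 0 = sum_encode (Inr n)" by (metis sum_decode_inverse)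
    then show ?thesis using p that(2) unfolding hub_vertex_def by metis
  qed
qed

section \<open>The graph is acyclic\<close>

text \<open>To see that the edge from \<open>a\<close> to \<open>hub_vertex n (tail n a)\<close> is a bridge, consider the sequences
  that agree with \<open>a\<close> from some \<open>N\<close> on; \<open>side n a N\<close> decides which of them are separated from the
  hub by that edge. The recursion follows a path from \<open>x\<close> to \<open>a\<close>. If \<open>x N \<noteq> a N\<close>, then entry \<open>N\<close> has to
  be corrected, which is possible only at the stem of length \<open>N\<close>; so the path arrives there, and
  from then on only the entries of that stem count. Once all entries beyond \<open>n\<close> are in place, \<open>x\<close> is
  on the side of \<open>a\<close> iff it already has the right entry at \<open>n\<close>; the recursion ends with this
  condition at \<open>Suc n\<close> and below.\<close>

primrec side :: "nat \<Rightarrow> (nat \<Rightarrow> nat) \<Rightarrow> nat \<Rightarrow> (nat \<Rightarrow> nat) \<Rightarrow> bool" where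
  "side n a 0 x \<longleftrightarrow> x n = a n"
| "side n a (Suc N) x \<longleftrightarrow>
     (if N \<le> n then x n = a n else side n a N (if x N = a N then x else stem N))"

text \<open>For sequences that agree with \<open>a\<close> from some point on, \<open>side n a N x\<close> does not depend on large
  \<open>N\<close>, so this is the limit of the sides.\<close>

definition bank :: "nat \<Rightarrow> (nat \<Rightarrow> nat) \<Rightarrow> (nat \<Rightarrow> nat) set" where
  "bank n a = {x. \<forall>\<^sub>F N in sequentially. x N = a N \<and> side n a N x}"

lemma side_cong: "n < N \<Longrightarrow> (\<And>i. i < N \<Longrightarrow> x i = y i) \<Longrightarrow> side n a N x \<longleftrightarrow> side n a N y"
proof (induction N)
  case (Suc N)
  show ?case
  proof (cases "N = n")
    case True
    then show ?thesis using Suc.prems(2)[of n] by simp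
  next
    case False
    then have "side n a N x \<longleftrightarrow> side n a N y" using Suc by simp
    then show ?thesis using Suc.prems(1) Suc.prems(2)[of N] False by simp
  qed
qed simp

lemma side_self: "side n a N a"
  by (induction N) auto

lemma side_above: "n < N \<Longrightarrow> (\<And>i. n < i \<Longrightarrow> x i = a i) \<Longrightarrow> side n a N x \<longleftrightarrow> x n = a n"
  by (induction N) (simp_all add: less_Suc_eq)

text \<open>Crossing a hub of level \<open>m \<noteq> n\<close> does not change the side: for \<open>m < n\<close> because entry \<open>m\<close> is never
  consulted, and for \<open>m > n\<close> because both sequences pass through the stem of length \<open>m\<close>, to which the
  recursion would redirect them anyway.\<close>

lemma side_jump:
  assumes off: "\<And>i. i \<noteq> m \<Longrightarrow> x i = y i" and "passes m x" "passes m y"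
    and "m \<noteq> n" "n < N" "m < N"
  shows "side n a N x \<longleftrightarrow> side n a N y"
  using assms(5,6)
proof (induction N)
  case (Suc N)
  consider "N \<le> n" | "n < N" "m = N" | "n < N" "m < N" using Suc.prems by linarith
  then show ?case
  proof cases
    case 1
    then show ?thesis using off[of n] \<open>m \<noteq> n\<close> by simp
  next
    case 2
    have "side n a N x \<longleftrightarrow> side n a N (stem N)" "side n a N y \<longleftrightarrow> side n a N (stem N)"
      using 2 assms(2,3) by (auto intro!: side_cong simp: passes_def)
    then show ?thesis using 2 by simp
  next
    case 3
    then show ?thesis using Suc.IH off[of N] by simp
  qed
qed simp

text \<open>A wrong entry at \<open>l > n\<close> makes the recursion replace everything below \<open>l\<close> by a stem, so that
  entry \<open>n\<close> is forgotten.\<close>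

lemma side_forget:
  assumes off: "\<And>i. n < i \<Longrightarrow> x i = y i" and "n < l" "x l \<noteq> a l" "l < N"
  shows "side n a N x \<longleftrightarrow> side n a N y"
  using assms(4)
proof (induction N)
  case (Suc N)
  show ?case
  proof (cases "N = l")
    case True
    then show ?thesis using off[of l] assms by simp
  next
    case False
    then show ?thesis using Suc off[of N] assms by simp
  qed
qed simp

text \<open>Every hub but the one at the removed edge falls under one of the two preceding reasons, so that
  its neighbours lie all on the bank or all off it.\<close>

lemma bank_jump:
  assumes "passes m x" "passes m y" "tail m x = tail m y" and "m = n \<Longrightarrow> tail n x \<noteq> tail n a"
  shows "x \<in> bank n a \<longleftrightarrow> y \<in> bank n a"
proof -
  have off: "x i = y i" if "i \<noteq> m" for i using assms(1-3) that by (rule passes_tail_eqD)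
  have "\<forall>\<^sub>F N in sequentially. side n a N x \<longleftrightarrow> side n a N y"
  proof (cases "m = n")
    case True
    then obtain i where i: "x (i + Suc n) \<noteq> a (i + Suc n)" using assms(4) by (auto simp: tail_def)
    have "side n a N x \<longleftrightarrow> side n a N y" if "N > i + Suc n" for N
      using off True i that by (intro side_forget[where l = "i + Suc n"]) auto
    then show ?thesis by (rule eventually_mono[OF eventually_gt_at_top])
  next
    case False
    have "side n a N x \<longleftrightarrow> side n a N y" if "N > m + n" for N
      using off False assms(1,2) that by (intro side_jump[where m = m]) auto
    then show ?thesis by (rule eventually_mono[OF eventually_gt_at_top])
  qed
  moreover have "\<forall>\<^sub>F N in sequentially. x N = y N"
    by (rule eventually_mono[OF eventually_gt_at_top[of m]]) (use off in auto)
  ultimately have "\<forall>\<^sub>F N in sequentially. (x N = a N \<and> side n a N x) \<longleftrightarrow> (y N = a N \<and> side n a N y)"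
    by eventually_elim auto
  then show ?thesis unfolding bank_def by (simp add: eventually_subst)
qed

lemma bank_self: "a \<in> bank n a"
  by (simp add: bank_def side_self)

text \<open>The neighbours of the hub at the removed edge differ from \<open>a\<close> at most at entry \<open>n\<close>, and that
  entry decides their side.\<close>

lemma bank_gate:
  assumes "passes n x" "passes n a" "tail n x = tail n a" "x \<in> bank n a"
  shows "x = a"
proof -
  have off: "x i = a i" if "i \<noteq> n" for i using assms(1-3) that by (rule passes_tail_eqD)
  obtain N0 where N0: "\<And>N. N \<ge> N0 \<Longrightarrow> side n a N x"
    using assms(4) by (auto simp: bank_def eventually_sequentially)
  have "x n = a n" using side_above[of n "N0 + Suc n" x a] N0[of "N0 + Suc n"] off
    by (simp del: side.simps)
  then show ?thesis using off by (intro ext) metis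
qed

lemma arcs_cases:
  assumes "(u, v) \<in> arcs"
  obtains (hub) n x where "passes n x" "u = tree_vertex [] x" "v = hub_vertex n (tail n x)"
  | (tree) t m x where "t = [] \<Longrightarrow> x \<in> thin" "u = tree_vertex t x" "v = tree_vertex (t @ [m]) x"
  using assms unfolding arcs_def by blast

lemma acyclic_hub_graph: "acyclic_graph V hub_graph"
  unfolding hub_graph_def
proof (rule acyclic_graph_if_bridges)
  fix p q assume "(p, q) \<in> arcs"
  then show "\<exists>S. p \<in> S \<and> q \<notin> S \<and> (\<forall>(u, v)\<in>arcs. (u \<in> S \<longleftrightarrow> v \<in> S) \<or> (u = p \<and> v = q))"
  proof (cases rule: arcs_cases)
    case (hub n a)
    \<comment> \<open>The cut takes with each sequence everything that hangs on it, and with each group of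
      neighbours their hub, except for the hub \<open>q\<close> itself.\<close>
    define S where "S = {tree_vertex t x | t x. x \<in> bank n a} \<union>
      {hub_vertex m (tail m x) | m x. passes m x \<and> x \<in> bank n a \<and> (m = n \<longrightarrow> tail n x \<noteq> tail n a)}"
    have "p \<in> S" "q \<notin> S" using hub bank_self by (auto simp: S_def)
    moreover have "(u \<in> S \<longleftrightarrow> v \<in> S) \<or> (u = p \<and> v = q)" if "(u, v) \<in> arcs" for u v
      using that
    proof (cases rule: arcs_cases)
      case h: (hub m x)
      show ?thesis
      proof (cases "m = n \<and> tail n x = tail n a")
        case True
        then show ?thesis using h hub bank_gate[of n x a] by (auto simp: S_def)
      next
        case False
        have "v \<in> S \<longleftrightarrow> (\<exists>y. passes m y \<and> tail m y = tail m x \<and> y \<in> bank n a)"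
        proof
          assume "v \<in> S"
          then obtain y where "passes m y" "tail m y = tail m x" "y \<in> bank n a"
            unfolding S_def h(3) by auto
          then show "\<exists>y. passes m y \<and> tail m y = tail m x \<and> y \<in> bank n a" by blast
        next
          assume "\<exists>y. passes m y \<and> tail m y = tail m x \<and> y \<in> bank n a"
          then obtain y where y: "passes m y" "tail m y = tail m x" "y \<in> bank n a" by blast
          moreover have "m = n \<longrightarrow> tail n y \<noteq> tail n a" using False y(2) by auto
          moreover have "v = hub_vertex m (tail m y)" using h(3) y(2) by simp
          ultimately show "v \<in> S" unfolding S_def by blast
        qed
        also have "\<dots> \<longleftrightarrow> x \<in> bank n a"
          using False bank_jump[of m x _ n a] h(1) by metis
        finally show ?thesis by (simp add: S_def h(2))
      qed
    next
      case (tree t m x)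
      then show ?thesis by (simp add: S_def)
    qed
    ultimately show ?thesis by blast
  next
    case (tree t m a)
    \<comment> \<open>The subtree below \<open>q\<close> has no other way out than \<open>p\<close>.\<close>
    define S where "S = - {tree_vertex (t @ [m] @ r) a | r. True}"
    have "p \<in> S" "q \<notin> S" using tree by (auto simp: S_def)
    moreover have "(u \<in> S \<longleftrightarrow> v \<in> S) \<or> (u = p \<and> v = q)" if "(u, v) \<in> arcs" for u v
      using that
    proof (cases rule: arcs_cases)
      case (hub k x)
      then show ?thesis by (auto simp: S_def)
    next
      case s: (tree s k x)
      show ?thesis
      proof (cases "x = a")
        case True
        have "(\<exists>r. s @ [k] = t @ [m] @ r) \<longleftrightarrow> (\<exists>r. s = t @ [m] @ r) \<or> (s = t \<and> k = m)"
        proof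
          assume "\<exists>r. s @ [k] = t @ [m] @ r"
          then obtain r where r: "s @ [k] = t @ [m] @ r" by blast
          show "(\<exists>r. s = t @ [m] @ r) \<or> (s = t \<and> k = m)"
          proof (cases r rule: rev_cases)
            case Nil
            then show ?thesis using r by simp
          next
            case (snoc r' c)
            then show ?thesis using r by simp
          qed
        qed auto
        then show ?thesis using s tree True by (auto simp: S_def)
      next
        case False
        then show ?thesis using s by (auto simp: S_def)
      qed
    qed
    ultimately show ?thesis by blast
  qed
qed

section \<open>The graph is regular\<close>

lemma aleph0_regular_hub_graph: "aleph0_regular UNIV hub_graph"
  unfolding aleph0_regular_def
proof
  fix y :: point
  let ?N = "{x \<in> UNIV. (x, y) \<in> hub_graph}"
  have "countable ?N \<and> infinite ?N"
  proof (cases y rule: vertex_cases)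
    case (1 t x)
    have "?N \<subseteq> range (\<lambda>n. hub_vertex n (tail n x)) \<union> range (\<lambda>s. tree_vertex s x)"
      by (auto simp: hub_graph_def arcs_def 1)
    then have "countable ?N" by (rule countable_subset) auto
    moreover have "infinite ?N"
    proof (cases "t = [] \<and> x \<notin> thin")
      case True
      then have "infinite ((\<lambda>n. hub_vertex n (tail n x)) ` {n. passes n x})"
        by (subst finite_image_iff) (auto simp: inj_on_def thin_def)
      moreover have "(\<lambda>n. hub_vertex n (tail n x)) ` {n. passes n x} \<subseteq> ?N"
        using True 1 by (auto simp: hub_graph_def arcs_def)
      ultimately show ?thesis by (rule infinite_super[rotated])
    next
      case False
      then have "range (\<lambda>m. tree_vertex (t @ [m]) x) \<subseteq> ?N"
        by (auto simp: hub_graph_def arcs_def 1)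
      moreover have "infinite (range (\<lambda>m. tree_vertex (t @ [m]) x))"
        by (rule range_inj_infinite) (auto simp: inj_def)
      ultimately show ?thesis by (rule infinite_super)
    qed
    ultimately show ?thesis ..
  next
    case (2 n z)
    have "?N = range (\<lambda>k. tree_vertex [] (glue n k z))"
    proof
      show "?N \<subseteq> range (\<lambda>k. tree_vertex [] (glue n k z))"
      proof
        fix p assume "p \<in> ?N"
        then obtain x where "p = tree_vertex [] x" "passes n x" "z = tail n x"
          by (auto simp: hub_graph_def arcs_def 2)
        then show "p \<in> range (\<lambda>k. tree_vertex [] (glue n k z))"
          using glue_tail[of n x] by (metis rangeI)
      qed
      show "range (\<lambda>k. tree_vertex [] (glue n k z)) \<subseteq> ?N"
        unfolding hub_graph_def arcs_def 2 by (force intro: passes_glue tail_glue[symmetric])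
    qed
    moreover have "infinite (range (\<lambda>k. tree_vertex [] (glue n k z)))"
      by (rule range_inj_infinite) (auto simp: inj_def dest: fun_cong[of _ _ n])
    ultimately show ?thesis by simp
  qed
  then show "?N \<approx> (UNIV :: nat set)"
    unfolding eqpoll_def by (metis countableE_infinite)
qed

section \<open>The graph is Borel\<close>

lemma Borel_of_euclidean: "Borel_of euclidean = borel"
  by (simp add: Borel_of_def borel_def)

lemma arcs_borel: "arcs \<in> sets borel"
proof -
  let ?cx = "\<lambda>t. sum_encode (Inl (list_encode t))"
  let ?thin = "\<lambda>p :: point. \<exists>j. \<forall>n>j. \<not> (\<forall>i<n. p (Suc i) = stem n i)"
  have thin: "(\<lambda>i. p (Suc i)) \<in> thin \<longleftrightarrow> ?thin p" for p :: point
    by (auto simp: thin_def passes_def finite_nat_set_iff_bounded_le) (meson not_le)+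
  have tv: "p = tree_vertex t x \<longleftrightarrow> p 0 = ?cx t \<and> x = (\<lambda>i. p (Suc i))" for p t x
    by (auto simp: tree_vertex_def fun_eq_iff split: nat.splits)
  have hv: "p = hub_vertex n z \<longleftrightarrow> p 0 = sum_encode (Inr n) \<and> z = (\<lambda>i. p (Suc i))" for p n z
    by (auto simp: hub_vertex_def fun_eq_iff split: nat.splits)
  let ?sh = "\<lambda>(p :: point) i. p (Suc i)"
  have arcs_iff: "(u, v) \<in> arcs \<longleftrightarrow>
      (\<exists>n. u 0 = ?cx [] \<and> (\<forall>i<n. u (Suc i) = stem n i) \<and> v 0 = sum_encode (Inr n) \<and>
           (\<forall>i. u (Suc (i + Suc n)) = v (Suc i))) \<or>
      (\<exists>t m. u 0 = ?cx t \<and> v 0 = ?cx (t @ [m]) \<and> (\<forall>i. u (Suc i) = v (Suc i)) \<and>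
           (t = [] \<longrightarrow> ?thin u))" (is "_ \<longleftrightarrow> ?R") for u v
  proof -
    have "(u, v) \<in> arcs \<longleftrightarrow>
        (\<exists>n x. u = tree_vertex [] x \<and> v = hub_vertex n (tail n x) \<and> passes n x) \<or>
        (\<exists>t m x. u = tree_vertex t x \<and> v = tree_vertex (t @ [m]) x \<and> (t = [] \<longrightarrow> x \<in> thin))"
      unfolding arcs_def by blast
    also have "\<dots> \<longleftrightarrow>
        (\<exists>n. u 0 = ?cx [] \<and> passes n (?sh u) \<and> v 0 = sum_encode (Inr n) \<and> tail n (?sh u) = ?sh v) \<or>
        (\<exists>t m. u 0 = ?cx t \<and> v 0 = ?cx (t @ [m]) \<and> ?sh u = ?sh v \<and> (t = [] \<longrightarrow> ?sh u \<in> thin))"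
      unfolding tv hv by (intro arg_cong2[of _ _ _ _ "(\<or>)"] ex_cong1) auto
    also have "\<dots> \<longleftrightarrow> ?R"
      by (simp only: thin passes_def tail_def fun_eq_iff)
    finally show ?thesis .
  qed
  have co: "continuous_on UNIV (\<lambda>w :: point \<times> point. fst w i)"
    "continuous_on UNIV (\<lambda>w :: point \<times> point. snd w i)" for i
    by (rule continuous_on_compose2[OF continuous_on_product_coordinates[of i]];
        auto intro: continuous_intros)+
  have [measurable]: "Measurable.pred borel (\<lambda>w :: point \<times> point. fst w i = c)"
    "Measurable.pred borel (\<lambda>w :: point \<times> point. snd w i = c)"
    "Measurable.pred borel (\<lambda>w :: point \<times> point. fst w i = snd w j)" for i j c
    by (auto simp: pred_def intro!: borel_closed closed_Collect_eq co continuous_on_const)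
  have "Measurable.pred borel (\<lambda>w :: point \<times> point.
      (\<exists>n. fst w 0 = ?cx [] \<and> (\<forall>i<n. fst w (Suc i) = stem n i) \<and> snd w 0 = sum_encode (Inr n) \<and>
           (\<forall>i. fst w (Suc (i + Suc n)) = snd w (Suc i))) \<or>
      (\<exists>t m. fst w 0 = ?cx t \<and> snd w 0 = ?cx (t @ [m]) \<and> (\<forall>i. fst w (Suc i) = snd w (Suc i)) \<and>
           (t = [] \<longrightarrow> ?thin (fst w))))"
    by (intro pred_intros_logic pred_intros_countable) measurable
  also have "(\<lambda>w. (\<exists>n. fst w 0 = ?cx [] \<and> (\<forall>i<n. fst w (Suc i) = stem n i) \<and> snd w 0 = sum_encode (Inr n) \<and>
           (\<forall>i. fst w (Suc (i + Suc n)) = snd w (Suc i))) \<or>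
      (\<exists>t m. fst w 0 = ?cx t \<and> snd w 0 = ?cx (t @ [m]) \<and> (\<forall>i. fst w (Suc i) = snd w (Suc i)) \<and>
           (t = [] \<longrightarrow> ?thin (fst w)))) = (\<lambda>w. w \<in> arcs)"
    unfolding arcs_iff[symmetric] by simp
  finally show ?thesis by (simp add: pred_def)
qed

lemma Borel_hub_graph: "Borel_graph euclidean hub_graph"
proof -
  have swap: "(\<lambda>w :: point \<times> point. (snd w, fst w)) \<in> borel_measurable borel"
    by (intro borel_measurable_continuous_onI continuous_intros)
  have "arcs\<inverse> = (\<lambda>w. (snd w, fst w)) -` arcs \<inter> space borel" by auto
  then have "arcs\<inverse> \<in> sets borel" using measurable_sets[OF swap arcs_borel] by simp
  then have "hub_graph \<in> sets borel" using arcs_borel by (simp add: hub_graph_def)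
  moreover have "graph_on UNIV hub_graph"
    unfolding graph_on_def by (auto simp: hub_graph_def irrefl_def arcs_def intro: sym_Un_converse)
  ultimately show ?thesis
    by (simp add: Borel_graph_def Borel_of_euclidean)
qed

section \<open>Topology of the cylinders\<close>

lemma open_prefix: "open {x :: nat \<Rightarrow> nat. \<forall>i<N. x i = s i}"
proof -
  have "{x :: nat \<Rightarrow> nat. \<forall>i<N. x i = s i} = (\<Inter>i<N. (\<lambda>x. x i) -` {s i})" by auto
  moreover have "open ((\<lambda>x :: nat \<Rightarrow> nat. x i) -` {s i})" for i
    by (intro open_vimage open_discrete continuous_on_product_coordinates)
  ultimately show ?thesis by auto
qed

lemma open_contains_prefix:
  fixes U :: "(nat \<Rightarrow> nat) set"
  assumes "open U" "x \<in> U"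
  obtains N where "\<And>y. (\<And>i. i < N \<Longrightarrow> y i = x i) \<Longrightarrow> y \<in> U"
proof -
  have "openin (product_topology (\<lambda>i. euclidean) UNIV) U"
    using assms(1) by (simp add: euclidean_product_topology)
  from product_topology_open_contains_basis[OF this assms(2)] obtain X :: "nat \<Rightarrow> nat set"
    where X: "x \<in> (\<Pi>\<^sub>E i\<in>UNIV. X i)" "finite {i. X i \<noteq> UNIV}" "(\<Pi>\<^sub>E i\<in>UNIV. X i) \<subseteq> U"
    by auto
  obtain N where N: "\<And>i. X i \<noteq> UNIV \<Longrightarrow> i < N"
    using X(2) by (auto simp: finite_nat_set_iff_bounded)
  show ?thesis
  proof
    fix y :: "nat \<Rightarrow> nat" assume "\<And>i. i < N \<Longrightarrow> y i = x i"
    then have "y \<in> (\<Pi>\<^sub>E i\<in>UNIV. X i)" using X(1) N by (fastforce simp: PiE_iff)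
    then show "y \<in> U" using X(3) by blast
  qed
qed

lemma open_contains_cylinder:
  assumes "open U" "U \<noteq> {}"
  obtains n where "n > j" "\<And>x. passes n x \<Longrightarrow> x \<in> U"
proof -
  obtain x where x: "x \<in> U" using assms(2) by blast
  obtain N where N: "\<And>y. (\<And>i. i < N \<Longrightarrow> y i = x i) \<Longrightarrow> y \<in> U"
    using open_contains_prefix[OF assms(1) x] by metis
  obtain n where n: "n \<ge> N + Suc j" "\<forall>i<N. stem n i = x i" using stem_dense by blast
  show ?thesis
    by (rule that[of n]) (use n N in \<open>auto simp: passes_def\<close>)
qed

lemma thin_meager: "meager_in euclidean thin"
proof -
  define K where "K j = {x. \<forall>n>j. \<not> passes n x}" for j
  have "thin \<subseteq> (\<Union>j. K j)"
    by (auto simp: K_def thin_def finite_nat_set_iff_bounded_le) (meson not_le)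
  moreover have "meager_in euclidean (K j)" for j
  proof (rule closed_meager)
    have "- K j = (\<Union>n\<in>{j<..}. {x. \<forall>i<n. x i = stem n i})"
      by (auto simp: K_def passes_def)
    then show "closed (K j)"
      unfolding closed_def using open_prefix by auto
    show "interior (K j) = {}"
    proof (rule ccontr)
      assume "interior (K j) \<noteq> {}"
      then obtain n where "n > j" "\<And>x. passes n x \<Longrightarrow> x \<in> interior (K j)"
        using open_contains_cylinder[OF open_interior, where j = j] by blast
      then have "glue n 0 x \<in> K j" for x using interior_subset[of "K j"] by auto
      then show False using \<open>n > j\<close> passes_glue unfolding K_def by blast
    qed
  qed
  ultimately show ?thesis
    using meager_in_subset[OF meager_in_UN[of UNIV euclidean K]] by simp
qed

text \<open>The image is cut out of the range by the preimage under the left inverse. In the applications,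
  \<open>f\<close> prepends finitely many fixed entries and \<open>g\<close> drops them.\<close>

lemma open_map_prepend:
  fixes f g :: "(nat \<Rightarrow> nat) \<Rightarrow> nat \<Rightarrow> nat"
  assumes "\<And>z. g (f z) = z" "continuous_on UNIV g" "open (range f)" "open U"
  shows "open (f ` U)"
proof -
  have "f ` U = range f \<inter> g -` U" using assms(1) by auto
  then show ?thesis using open_Int[OF assms(3) open_vimage[OF assms(4,2)]] by simp
qed

lemma range_case_nat: "range (case_nat (c :: nat)) = {p. \<forall>i<1. p i = c}"
proof safe
  fix p :: "nat \<Rightarrow> nat" assume "\<forall>i<1. p i = c"
  then have "p = case_nat c (\<lambda>i. p (Suc i))" by (auto simp: fun_eq_iff split: nat.splits)
  then show "p \<in> range (case_nat c)" by blast
qed simp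

lemma continuous_case_nat: "continuous_on UNIV (case_nat c :: (nat \<Rightarrow> nat) \<Rightarrow> nat \<Rightarrow> nat)"
proof -
  have "continuous_on UNIV (\<lambda>x :: nat \<Rightarrow> nat. case_nat c x i)" for i
    by (cases i) (auto intro: continuous_on_product_coordinates)
  then show ?thesis by (rule continuous_on_coordinatewise_then_product)
qed

lemma meager_vimage_case_nat:
  assumes "meager_in euclidean S"
  shows "meager_in euclidean (case_nat (c :: nat) -` S)"
proof (rule meager_vimage[OF continuous_case_nat _ assms])
  have "continuous_on UNIV (\<lambda>(p :: nat \<Rightarrow> nat) i. p (Suc i))"
    by (intro continuous_on_coordinatewise_then_product continuous_on_product_coordinates)
  moreover have "open (range (case_nat c))"
    unfolding range_case_nat by (rule open_prefix)
  ultimately show "open (case_nat c ` U)" if "open U" for U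
    using that by (rule open_map_prepend[rotated]) simp
qed

lemma meager_vimage_glue:
  assumes "meager_in euclidean S"
  shows "meager_in euclidean (glue n k -` S)"
proof (rule meager_vimage[OF _ _ assms])
  have "continuous_on UNIV (\<lambda>z. glue n k z i)" for i
    by (cases i n rule: linorder_cases) (simp_all add: glue_def)
  then show "continuous_on UNIV (glue n k)"
    by (rule continuous_on_coordinatewise_then_product)
  have range: "range (glue n k) = {x. \<forall>i<Suc n. x i = (if i < n then stem n i else k)}"
  proof safe
    fix x assume x: "\<forall>i<Suc n. x i = (if i < n then stem n i else k)"
    then have "passes n x" "x n = k" by (auto simp: passes_def)
    then show "x \<in> range (glue n k)" using glue_tail[of n x] by (metis rangeI)
  qed (auto simp: glue_def)
  have "continuous_on UNIV (tail n)"
    unfolding tail_def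
    by (intro continuous_on_coordinatewise_then_product continuous_on_product_coordinates)
  moreover have "open (range (glue n k))"
    unfolding range by (rule open_prefix)
  ultimately show "open (glue n k ` U)" if "open U" for U
    using that by (rule open_map_prepend[rotated]) simp
qed

section \<open>No Borel perfect matching on a comeager set\<close>

lemma sets_Borel_of_subtopology:
  assumes "C \<in> sets (borel :: 'a::topological_space measure)"
  shows "sets (Borel_of (subtopology euclidean C)) \<subseteq> sets borel"
proof
  fix A assume "A \<in> sets (Borel_of (subtopology euclidean C))"
  then have "A \<in> sigma_sets C {U. openin (subtopology euclidean C) U}"
    by (simp add: sets_Borel_of)
  then show "A \<in> sets borel"
  proof (induction rule: sigma_sets.induct)
    case (Basic a)
    then show ?case using assms by (auto simp: openin_subtopology)
  qed (use assms in auto)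
qed

lemma Borel_partial_function_vimage:
  assumes C: "C \<in> sets (borel :: 'a::topological_space measure)"
    and f: "Borel_partial_function (subtopology euclidean C) C f" and "open W"
  shows "f -` W \<inter> C \<in> sets borel"
proof -
  let ?B = "Borel_of (subtopology euclidean C)"
  have f: "f \<in> restrict_space ?B C \<rightarrow>\<^sub>M ?B" using f by (simp add: Borel_partial_function_def)
  have "openin (subtopology euclidean C) (W \<inter> C)" using \<open>open W\<close> by (auto simp: openin_subtopology)
  then have "W \<inter> C \<in> sets ?B" by (simp add: sets_Borel_of)
  then have "f -` (W \<inter> C) \<inter> C \<in> sets (restrict_space ?B C)"
    using measurable_sets[OF f] by (simp add: space_restrict_space del: vimage_Int)
  moreover have "f -` (W \<inter> C) \<inter> C = f -` W \<inter> C"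
    using measurable_space[OF f] by (auto simp: space_restrict_space)
  ultimately obtain A where A: "A \<in> sets ?B" "f -` W \<inter> C = C \<inter> A" by (auto simp: sets_restrict_space)
  then have "A \<in> sets borel" using sets_Borel_of_subtopology[OF C] by blast
  then show ?thesis using A C by auto
qed

text \<open>The hub level of the partner of a generic sequence is a Borel function of the sequence, so it has
  a constant value \<open>n\<close> on a comeager part of an open set \<open>U\<close>. Choose a stem of another length \<open>m\<close>
  inside \<open>U\<close>. All hubs of level \<open>m\<close> have their neighbours in \<open>U\<close>, where nearly all sequences are
  already matched to level \<open>n\<close>. So the hubs of level \<open>m\<close> can find partners only in a meager
  set, but meager sets have meager sets of neighbours.\<close>

lemma no_Borel_perfect_matching:
  assumes C: "C \<in> sets borel" and co: "comeager_in euclidean C"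
    and pm: "perfect_matching C (graph_restrict hub_graph C) C f"
    and bf: "Borel_partial_function (subtopology euclidean C) C f"
  shows False
proof -
  have f: "f p \<in> C" "f (f p) = p" "(p, f p) \<in> hub_graph" if "p \<in> C" for p
    using pm that by (auto simp: perfect_matching_def matching_def graph_restrict_def dest: bij_betwE)
  have mC: "meager_in euclidean (- C)" using co by (simp add: comeager_in_def Compl_eq_Diff_UNIV)
  \<comment> \<open>A sequence that is not thin has only hubs as neighbours.\<close>
  define P where "P n = {x. tree_vertex [] x \<in> C \<and> f (tree_vertex [] x) \<in> range (hub_vertex n)}" for n
  have "UNIV \<subseteq> tree_vertex [] -` (- C) \<union> thin \<union> (\<Union>n. P n)"
  proof
    fix x
    show "x \<in> tree_vertex [] -` (- C) \<union> thin \<union> (\<Union>n. P n)"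
    proof (cases "tree_vertex [] x \<in> C \<and> x \<notin> thin")
      case True
      then have "(tree_vertex [] x, f (tree_vertex [] x)) \<in> hub_graph" using f by blast
      then show ?thesis using True by (auto simp: hub_graph_def arcs_def P_def)
    qed auto
  qed
  then have "\<not> meager_in euclidean (tree_vertex [] -` (- C) \<union> thin \<union> (\<Union>n. P n))"
    using Baire_seq meager_in_subset[of euclidean _ UNIV] by blast
  moreover have "meager_in euclidean (tree_vertex [] -` (- C) \<union> thin)"
    using meager_vimage_case_nat[OF mC] thin_meager
    by (intro meager_in_Un) (simp_all add: tree_vertex_def[abs_def])
  ultimately obtain n where n: "\<not> meager_in euclidean (P n)"
    using meager_in_Un meager_in_UN[of UNIV euclidean P] by blast
  have "P n \<in> sets borel"
  proof -
    have W: "range (hub_vertex n) = {p. \<forall>i<1. p i = sum_encode (Inr n)}"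
      using range_case_nat by (simp only: hub_vertex_def[abs_def])
    have "f -` range (hub_vertex n) \<inter> C \<in> sets borel"
      unfolding W by (rule Borel_partial_function_vimage[OF C bf open_prefix])
    moreover have "P n = tree_vertex [] -` (f -` range (hub_vertex n) \<inter> C) \<inter> space borel"
      by (auto simp: P_def)
    ultimately show ?thesis
      using measurable_sets[OF borel_measurable_continuous_onI[OF continuous_case_nat]]
      unfolding tree_vertex_def[abs_def] by metis
  qed
  then obtain U where U: "open U" "U \<noteq> {}" "meager_in euclidean (U - P n)"
    using nonmeager_borel_localize n by blast
  obtain m where m: "m > n" "\<And>x. passes m x \<Longrightarrow> x \<in> U"
    using open_contains_cylinder[OF U(1,2)] by metis
  have "z \<in> hub_vertex m -` (- C) \<union> (\<Union>k. glue m k -` (U - P n))" for z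
  proof (cases "hub_vertex m z \<in> C")
    case True
    then have "(hub_vertex m z, f (hub_vertex m z)) \<in> hub_graph" using f by blast
    then obtain x where x: "f (hub_vertex m z) = tree_vertex [] x" "passes m x" "z = tail m x"
      by (auto simp: hub_graph_def arcs_def)
    have "f (tree_vertex [] x) = hub_vertex m z" using f(2)[OF True] x by simp
    then have "x \<in> U - P n" using m x(2) by (auto simp: P_def)
    then have "z \<in> glue m (x m) -` (U - P n)" using x glue_tail by simp
    then show ?thesis by blast
  qed simp
  then have "UNIV \<subseteq> hub_vertex m -` (- C) \<union> (\<Union>k. glue m k -` (U - P n))" by blast
  moreover have "meager_in euclidean (hub_vertex m -` (- C) \<union> (\<Union>k. glue m k -` (U - P n)))"
    using meager_vimage_case_nat[OF mC] meager_vimage_glue[OF U(3)]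
    by (intro meager_in_Un meager_in_UN) (simp_all add: hub_vertex_def[abs_def])
  ultimately show False using Baire_seq meager_in_subset[of euclidean _ UNIV] by blast
qed

theorem theorem3p10:
  shows "\<exists>(X :: point topology) G.
           Polish_space X \<and> Borel_graph X G \<and>
           acyclic_graph (topspace X) G \<and> aleph0_regular (topspace X) G \<and>
           \<not> (\<exists>C. C \<in> sets (Borel_of X) \<and> comeager_in X C \<and>
                has_Borel_perfect_matching (subtopology X C) (graph_restrict G C))"
proof (intro exI conjI)
  show "Polish_space (euclidean :: point topology)" by (rule Polish_seq)
  show "Borel_graph euclidean hub_graph" by (rule Borel_hub_graph)
  show "acyclic_graph (topspace euclidean) hub_graph" by (rule acyclic_hub_graph)
  show "aleph0_regular (topspace euclidean) hub_graph" using aleph0_regular_hub_graph by simp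
  show "\<not> (\<exists>C. C \<in> sets (Borel_of euclidean) \<and> comeager_in euclidean C \<and>
           has_Borel_perfect_matching (subtopology euclidean C) (graph_restrict hub_graph C))"
  proof
    assume "\<exists>C. C \<in> sets (Borel_of euclidean) \<and> comeager_in euclidean C \<and>
           has_Borel_perfect_matching (subtopology euclidean C) (graph_restrict hub_graph C)"
    then obtain C D f where C: "C \<in> sets borel" "comeager_in euclidean C"
      and pm: "perfect_matching C (graph_restrict hub_graph C) D f"
      and bf: "Borel_partial_function (subtopology euclidean C) D f"
      by (auto simp: has_Borel_perfect_matching_def Borel_of_euclidean)
    have "D = C" using pm by (simp add: perfect_matching_def)
    then show False using no_Borel_perfect_matching C pm bf by blast
  qed
qed

end
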